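(* Let $k$ be an odd positive integer such that $5k+2$ is prime, and let $m$ be a positive integer greater than $2$. Then $$F_{5mk}\equiv 5k\left(3^{m-1}+\sum_{i=1}^{m-1}3^{m-1-i}F_{3i-1}\right)\pmod{5k+2}$$ and $$F_{5mk+1}\equiv F_{3m-1}\pmod{5k+2}.$$
   Context: $(F_n)_{n\ge 0}$ denotes the Fibonacci sequence: $F_0=0$, $F_1=1$, $F_{n+2}=F_{n+1}+F_n$. *)

theory Defs
  imports "HOL-Number_Theory.Number_Theory"
begin

end

theory Submission
  imports Defs
begin

text \<open>
  Since \<open>p = 5k + 2\<close> is a quadratic non-residue modulo \<open>5\<close>, reciprocity and the binomial expansion
  of \<open>(1 + \<surd>5)\<^sup>p\<close> give \<open>F\<^sub>p \<equiv> -1\<close> and \<open>F\<^bsub>p+1\<^esub> \<equiv> 0\<close> modulo \<open>p\<close>, hence \<open>F\<^bsub>5k\<^esub> \<equiv> -2\<close> and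
  \<open>F\<^bsub>5k+1\<^esub> \<equiv> 1\<close>. The addition law then turns the step from \<open>m\<close> to \<open>m + 1\<close> into a linear recurrence
  for the pair \<open>(F\<^bsub>5mk\<^esub>, F\<^bsub>5mk+1\<^esub>)\<close> modulo \<open>p\<close>, which is also satisfied by \<open>(-F\<^bsub>3m\<^esub>, F\<^bsub>3m-1\<^esub>)\<close>.
  Finally \<open>5k \<equiv> -2\<close>, and \<open>F\<^bsub>3m\<^esub>\<close> is exactly twice the bracketed sum.
\<close>

text \<open>Pascal's rule for weighted sums: shifting the weights to \<open>c (Suc j)\<close> models
  multiplication by sqrt 5.\<close>

lemma binomial_sum_Suc:
  fixes c :: "nat \<Rightarrow> 'a::comm_semiring_1"
  shows "(\<Sum>j\<le>Suc n. of_nat (Suc n choose j) * c j) =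
    (\<Sum>j\<le>n. of_nat (n choose j) * c j) + (\<Sum>j\<le>n. of_nat (n choose j) * c (Suc j))"
proof -
  have "(\<Sum>j\<le>Suc n. of_nat (Suc n choose j) * c j) =
      c 0 + (\<Sum>j\<le>n. of_nat (n choose Suc j) * c (Suc j)) + (\<Sum>j\<le>n. of_nat (n choose j) * c (Suc j))"
    by (subst sum.atMost_Suc_shift) (simp add: sum.distrib algebra_simps)
  also have "c 0 + (\<Sum>j\<le>n. of_nat (n choose Suc j) * c (Suc j)) = (\<Sum>j\<le>Suc n. of_nat (n choose j) * c j)"
    by (subst sum.atMost_Suc_shift) simp
  also have "\<dots> = (\<Sum>j\<le>n. of_nat (n choose j) * c j)"
    by (simp add: binomial_eq_0)
  finally show ?thesis .
qed

text \<open>The coefficients of \<open>(1 + \<surd>5)\<^sup>n\<close>: the second identity concerns the Lucas number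
  \<open>L\<^sub>n = 2 F\<^bsub>n+1\<^esub> - F\<^sub>n\<close>.\<close>

lemma fib_binomial_sum:
  "2 ^ n * int (fib n) = 2 * (\<Sum>j\<le>n. int (n choose j) * (if even j then 0 else 5 ^ (j div 2)))"
  "2 ^ n * (2 * int (fib (Suc n)) - int (fib n)) =
    2 * (\<Sum>j\<le>n. int (n choose j) * (if even j then 5 ^ (j div 2) else 0))"
proof (induction n)
  case 0
  {
    case 1
    show ?case by simp
  next
    case 2
    show ?case by simp
  }
next
  case (Suc n)
  let ?e = "\<lambda>j. if even j then 0 else 5 ^ (j div 2) :: int"
  let ?d = "\<lambda>j. if even j then 5 ^ (j div 2) else 0 :: int"
  \<comment> \<open>Multiplying by sqrt 5 swaps the rational and irrational parts; one direction
    brings a factor 5.\<close>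
  have e: "?e (Suc j) = ?d j" and d: "?d (Suc j) = 5 * ?e j" for j
    by auto
  have B: "(\<Sum>j\<le>Suc n. int (Suc n choose j) * ?e j) =
      (\<Sum>j\<le>n. int (n choose j) * ?e j) + (\<Sum>j\<le>n. int (n choose j) * ?d j)"
    unfolding binomial_sum_Suc e ..
  have A: "(\<Sum>j\<le>Suc n. int (Suc n choose j) * ?d j) =
      (\<Sum>j\<le>n. int (n choose j) * ?d j) + 5 * (\<Sum>j\<le>n. int (n choose j) * ?e j)"
    unfolding binomial_sum_Suc d sum_distrib_left by (simp only: ac_simps)
  {
    case 1
    show ?case
      unfolding B distrib_left Suc.IH[symmetric] by (simp add: algebra_simps)
  next
    case 2
    show ?case
      unfolding A distrib_left mult.left_commute[of 2 5] Suc.IH[symmetric] by (simp add: algebra_simps)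
  }
qed

text \<open>A prime divides its inner binomial coefficients, so only the end terms survive.\<close>

lemma binomial_sum_prime_cong:
  fixes c :: "nat \<Rightarrow> int"
  assumes "prime p"
  shows "[(\<Sum>j\<le>p. int (p choose j) * c j) = c 0 + c p] (mod int p)"
proof -
  have p: "p > 0" using assms by (rule prime_gt_0_nat)
  then have "{..p} = insert 0 (insert p {1..<p})"
    by auto
  then have "(\<Sum>j\<le>p. int (p choose j) * c j) = c 0 + c p + (\<Sum>j = 1..<p. int (p choose j) * c j)"
    using p by simp
  moreover have "int p dvd (\<Sum>j = 1..<p. int (p choose j) * c j)"
    using assms by (intro dvd_sum dvd_mult2) (auto intro!: dvd_choose_prime)
  ultimately show ?thesis
    by (simp add: cong_iff_dvd_diff)
qed

lemma fib_prime_cong: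
  assumes "prime p" "p > 2"
  shows "[int (fib p) = Legendre 5 p] (mod int p)"
    and "[2 * int (fib (Suc p)) = 1 + Legendre 5 p] (mod int p)"
proof -
  have "odd p" using assms by (simp add: prime_odd_nat)
  then have cop: "coprime 2 (int p)"
    by simp
  have "\<not> p dvd 2"
    using assms by (auto dest: dvd_imp_le)
  then have "[2 ^ (p - 1) = 1] (mod p)"
    using assms by (intro fermat_theorem)
  then have F: "[2 ^ (p - 1) = (1::int)] (mod int p)"
    by (metis cong_int_iff of_nat_1 of_nat_numeral of_nat_power)
  \<comment> \<open>The factor split off cancels the 2 in \<open>fib_binomial_sum\<close>; the
    remaining power is 1 modulo \<open>p\<close> by Fermat.\<close>
  have p2: "(2::int) ^ p = 2 * 2 ^ (p - 1)"
    using assms by (cases p) auto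
  have euler: "[5 ^ (p div 2) = Legendre 5 p] (mod int p)"
    using euler_criterion[OF assms, of 5] \<open>odd p\<close> by (auto elim!: oddE simp: cong_sym_eq)
  have "[2 ^ (p - 1) * int (fib p) = 5 ^ (p div 2)] (mod int p)"
    using binomial_sum_prime_cong[OF assms(1), of "\<lambda>j. if even j then 0 else 5 ^ (j div 2)"]
      fib_binomial_sum(1)[of p] \<open>odd p\<close> by (simp add: p2)
  then show 1: "[int (fib p) = Legendre 5 p] (mod int p)"
    by (metis F euler cong_scalar_right cong_sym cong_trans mult_1)
  have "[2 ^ (p - 1) * (2 * int (fib (Suc p)) - int (fib p)) = 1] (mod int p)"
    using binomial_sum_prime_cong[OF assms(1), of "\<lambda>j. if even j then 5 ^ (j div 2) else 0"]
      fib_binomial_sum(2)[of p] \<open>odd p\<close> by (simp add: p2)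
  then have "[2 * int (fib (Suc p)) - int (fib p) = 1] (mod int p)"
    by (metis F cong_scalar_right cong_sym cong_trans mult_1)
  from cong_add[OF this 1] show "[2 * int (fib (Suc p)) = 1 + Legendre 5 p] (mod int p)"
    by simp
qed

text \<open>Reciprocity brings no sign, since 5 is 1 modulo 4. By Euler's criterion the flipped
  symbol is \<open>2 ^ 2 = 4\<close> modulo 5, hence -1.\<close>

lemma Legendre_5_eq_neg_1:
  assumes "prime p" "p > 2" "[p = 2] (mod 5)"
  shows "Legendre 5 (int p) = -1"
proof -
  have "[int p = 2] (mod 5)"
    using assms(3) by (metis cong_int_iff of_nat_numeral)
  then have "[int p ^ 2 = 2 ^ 2] (mod 5)"
    by (rule cong_pow)
  moreover have "[Legendre (int p) 5 = int p ^ 2] (mod 5)"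
    using euler_criterion[of 5 "int p"] by simp
  ultimately have "[Legendre (int p) 5 = 4] (mod 5)"
    by (auto intro: cong_trans)
  then have "Legendre (int p) 5 = -1"
    by (auto simp: Legendre_def cong_def split: if_splits)
  moreover have "p \<noteq> 5"
    using assms(3) by (auto simp: cong_def)
  ultimately show ?thesis
    using Quadratic_Reciprocity[of p 5] assms by simp
qed

text \<open>Unrolls \<open>F(j + 3) = 3 F(j) + 2 F(j - 1)\<close> from \<open>F(3) = 2\<close>, with
  the common factor 2 taken out.\<close>

lemma fib_3_mult_eq_sum:
  "fib (3 * Suc n) = 2 * (3 ^ n + (\<Sum>i = 1..n. 3 ^ (n - i) * fib (3 * i - 1)))"
proof (induction n)
  case 0
  show ?case by (simp add: numeral_3_eq_3)
next
  case (Suc n)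
  have "(\<Sum>i = 1..n. 3 ^ (Suc n - i) * fib (3 * i - 1)) = 3 * (\<Sum>i = 1..n. 3 ^ (n - i) * fib (3 * i - 1))"
    unfolding sum_distrib_left by (intro sum.cong) (auto simp: Suc_diff_le)
  moreover have "fib (3 * Suc (Suc n)) = 3 * fib (3 * Suc n) + 2 * fib (3 * Suc n - 1)"
    by (simp add: eval_nat_numeral)
  ultimately show ?case
    using Suc.IH by simp
qed

lemma fib_mult_cong:
  assumes "[int (fib q) = -2] (mod M)" "[int (fib (Suc q)) = 1] (mod M)"
  shows "[int (fib (Suc n * q)) = - int (fib (3 * Suc n))] (mod M) \<and>
    [int (fib (Suc (Suc n * q))) = int (fib (3 * Suc n - 1))] (mod M)"
proof (induction n)
  case 0
  show ?case using assms by (simp add: eval_nat_numeral)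
next
  case (Suc n)
  define a where "a = Suc n * q"
  have a: "Suc (Suc n) * q = a + q"
    by (simp add: a_def)
  have s1: "int (fib (Suc (a + q))) = int (fib (Suc q)) * int (fib (Suc a)) + int (fib q) * int (fib a)"
    by (simp only: fib_add of_nat_add of_nat_mult)
  text \<open>The addition law for \<open>F\<^bsub>a+q\<^esub>\<close>, with \<open>F\<^bsub>a-1\<^esub>\<close> replaced by \<open>F\<^bsub>a+1\<^esub> - F\<^sub>a\<close>.\<close>
  have s0: "int (fib (a + q)) =
      int (fib (Suc q)) * int (fib a) + int (fib q) * (int (fib (Suc a)) - int (fib a))"
    using fib_add[of "a - 1" q] by (cases a) (simp_all add: algebra_simps)
  \<comment> \<open>With \<open>j = 3 * Suc n\<close>, this right-hand side collapses to
    \<open>- F(j + 3)\<close> and the next one to \<open>F(j + 2)\<close>.\<close>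
  have "[int (fib (a + q)) = 1 * (- int (fib (3 * Suc n))) +
      (-2) * (int (fib (3 * Suc n - 1)) - (- int (fib (3 * Suc n))))] (mod M)"
    unfolding s0 using Suc.IH by (intro cong_add cong_mult cong_diff assms) (auto simp only: a_def)
  moreover have "[int (fib (Suc (a + q))) = 1 * int (fib (3 * Suc n - 1)) +
      (-2) * (- int (fib (3 * Suc n)))] (mod M)"
    unfolding s1 using Suc.IH by (intro cong_add cong_mult assms) (auto simp only: a_def)
  ultimately show ?case
    unfolding a by (simp add: eval_nat_numeral algebra_simps)
qed

theorem theorem3p5:
  fixes k m :: nat
  assumes "odd k" and "k > 0" and "prime (5 * k + 2)" and "m > 2"
  shows "[fib (5 * m * k) =
            5 * k * (3 ^ (m - 1) + (\<Sum>i = 1..m - 1. 3 ^ (m - 1 - i) * fib (3 * i - 1)))]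
          (mod (5 * k + 2))
       \<and> [fib (5 * m * k + 1) = fib (3 * m - 1)] (mod (5 * k + 2))"
proof -
  define p where "p = 5 * k + 2"
  have p: "prime p" "p > 2"
    using assms by (auto simp: p_def)
  have L: "Legendre 5 (int p) = -1"
  proof (rule Legendre_5_eq_neg_1[OF p])
    show "[p = 2] (mod 5)"
      unfolding p_def cong_def by presburger
  qed
  have P: "[int (fib p) = -1] (mod int p)"
    using fib_prime_cong(1)[OF p] by (simp add: L)
  have "int p dvd 2 * int (fib (Suc p))"
    using fib_prime_cong(2)[OF p] by (simp add: L cong_0_iff)
  moreover have "coprime (int p) 2"
    using p by (simp add: prime_odd_nat)
  ultimately have SP: "[int (fib (Suc p)) = 0] (mod int p)"
    by (simp add: coprime_dvd_mult_right_iff cong_0_iff)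
  \<comment> \<open>Running the recurrence backwards from \<open>p\<close> and \<open>p + 1\<close>
    reaches \<open>5 * k = p - 2\<close>.\<close>
  have "int (fib (Suc (5 * k))) = int (fib (Suc p)) - int (fib p)"
    by (simp add: p_def)
  with cong_diff[OF SP P] have 1: "[int (fib (Suc (5 * k))) = 1] (mod int p)"
    by simp
  have "int (fib (5 * k)) = int (fib p) - int (fib (Suc (5 * k)))"
    by (simp add: p_def)
  with cong_diff[OF P 1] have 0: "[int (fib (5 * k)) = -2] (mod int p)"
    by simp
  obtain n where m: "m = Suc n"
    using assms(4) by (cases m) auto
  define T where "T = 3 ^ n + (\<Sum>i = 1..n. 3 ^ (n - i) * fib (3 * i - 1))"
  have mk: "5 * m * k = Suc n * (5 * k)"
    by (simp add: m algebra_simps)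
  have "[int (fib (5 * m * k)) = - int (fib (3 * m))] (mod int p)"
    and second: "[int (fib (Suc (5 * m * k))) = int (fib (3 * m - 1))] (mod int p)"
    unfolding mk unfolding m using fib_mult_cong[OF 0 1, of n] by blast+
  then have "[int (fib (5 * m * k)) = - 2 * int T] (mod int p)"
    unfolding m fib_3_mult_eq_sum T_def[symmetric] by simp
  moreover have "[int (5 * k) * int T = - 2 * int T] (mod int p)"
    by (rule cong_scalar_right) (simp add: cong_iff_dvd_diff p_def add.commute)
  ultimately have "[int (fib (5 * m * k)) = int (5 * k * T)] (mod int p)"
    by (simp add: cong_def)
  then show ?thesis
    using second unfolding cong_int_iff by (simp add: m T_def p_def)
qed

end
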